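(* Let $a,b,c$ be positive integers, let $w_0,w_1$ be arbitrary, and let $\{w_n\}$ be defined by $w_n=aw_{n-1}+cw_{n-2}$ for $n\ge2$ even and $w_n=bw_{n-1}+cw_{n-2}$ for $n\ge2$ odd. Let $\{v_n\}$ satisfy the same recurrence with $v_0=2$, $v_1=b$. Then for nonnegative integers $n,r,m$ with $m>1$, $$w_{2mn+r}=\sum_{i=0}^{n}\binom ni(-1)^{(m+1)(n-i)}\left(\frac ab\right)^{\xi(m)\left(\frac{i+\xi(i)}{2}\right)-\xi(im)\xi(r)}c^{m(n-i)}v_m^{i}\,w_{im+r}.$$
   Context: $\xi(n)=n-2\lfloor n/2\rfloor$ is the parity function. *)

theory Defs
  imports Complex_Main
begin

definition xi :: "nat \<Rightarrow> int" where
  "xi n = int n - 2 * \<lfloor>real n / 2\<rfloor>"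

fun biperiodic :: "nat \<Rightarrow> nat \<Rightarrow> nat \<Rightarrow> 'a::field_char_0 \<Rightarrow> 'a \<Rightarrow> nat \<Rightarrow> 'a" where
  "biperiodic a b c x0 x1 0 = x0"
| "biperiodic a b c x0 x1 (Suc 0) = x1"
| "biperiodic a b c x0 x1 (Suc (Suc n)) =
     (if even (Suc (Suc n)) then of_nat a else of_nat b) * biperiodic a b c x0 x1 (Suc n)
     + of_nat c * biperiodic a b c x0 x1 n"

end

theory Submission
  imports Defs
begin

text \<open>With \<open>p = sqrt (a b)\<close>, rescaling the odd-indexed terms by \<open>sqrt (a / b)\<close> turns both sequences
  into solutions of \<open>W (n + 2) = p W (n + 1) + c W n\<close>, for which
  \<open>W (r + 2 m) = V m W (r + m) - (- c) ^ m W r\<close>. Undoing the rescaling puts the factor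
  \<open>parity_factor (a / b) m r\<close> in front of \<open>v m\<close>. Iterating this three-term relation \<open>n\<close> times
  gives the binomial expansion of \<open>x ^ (2 m n) = (V m x ^ m + d) ^ n\<close> with \<open>d = - (- c) ^ m\<close>,
  where \<open>x\<close> stands for the index shift.\<close>

text \<open>With \<open>s\<close> a square root of \<open>q\<close>, this is \<open>s\<close> to the
  power \<open>xi m + xi (r + m) - xi r\<close>, the trace left by undoing the rescaling. That
  exponent is always 0 or 2, so no square root is needed.\<close>

definition parity_factor :: "'a::one \<Rightarrow> nat \<Rightarrow> nat \<Rightarrow> 'a" where
  "parity_factor q m r = (if odd m \<and> even r then q else 1)"

lemma xi_eq: "xi n = (if even n then 0 else 1)"
proof -
  have "\<lfloor>real n / 2\<rfloor> = int n div 2"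
    using floor_divide_of_nat_eq[where 'a = real, of n 2] by simp
  then show ?thesis
    unfolding xi_def by presburger
qed

lemma biperiodic_rec:
  "biperiodic a b c x y (n + 2) =
     (if even n then of_nat a else of_nat b) * biperiodic a b c x y (n + 1)
     + of_nat c * biperiodic a b c x y n"
  by simp

lemma biperiodic_double_shift:
  fixes a b c :: nat and x0 x1 :: "'a::field_char_0"
  assumes "b > 0"
  defines "w \<equiv> biperiodic a b c x0 x1" and "v \<equiv> biperiodic a b c 2 (of_nat b)"
  shows "w (r + 2 * m) =
    parity_factor (of_nat a / of_nat b) m r * v m * w (r + m) - (- of_nat c) ^ m * w r"
proof (induction m arbitrary: r rule: induct_nat_012)
  case 0
  show ?case by (simp add: v_def parity_factor_def)
next
  case 1
  show ?case
    using biperiodic_rec[of a b c x0 x1 r] assms(1)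
    by (simp add: v_def w_def parity_factor_def)
next
  case (ge2 m)
  define q :: "nat \<Rightarrow> 'a" where "q n = (if even n then of_nat a else of_nat b)" for n
  let ?k = "parity_factor (of_nat a / of_nat b :: 'a)"
  have w_rec: "w (n + 2) = q n * w (n + 1) + of_nat c * w n" for n
    unfolding w_def q_def by (rule biperiodic_rec)
  have v_rec: "v (m + 2) = q m * v (m + 1) + of_nat c * v m"
    unfolding v_def q_def by (rule biperiodic_rec)
  \<comment> \<open>Trades the coefficient of the \<open>w\<close> recurrence at \<open>r\<close>
    for that of the \<open>v\<close> recurrence at \<open>m\<close>.\<close>
  have k1: "q r * ?k (m + 1) (r + 1) = ?k m r * q m"
    using assms(1) by (simp add: q_def parity_factor_def)
  have k2: "?k m (r + 2) = ?k m r" "?k (m + 2) r = ?k m r"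
    by (simp_all add: parity_factor_def)
  \<comment> \<open>The shifts \<open>r + 1\<close> here and \<open>r + 2\<close> in
    \<open>IH0\<close> give both instances the same middle term
    \<open>w (r + m + 2)\<close>.\<close>
  have IH1: "w (r + 2 * m + 3) =
      ?k (m + 1) (r + 1) * v (m + 1) * w (r + m + 2) + of_nat c * (- of_nat c) ^ m * w (r + 1)"
    using ge2.IH(2)[of "r + 1"] by (simp add: eval_nat_numeral)
  have IH0: "w (r + 2 * m + 2) =
      ?k m r * v m * w (r + m + 2) - (- of_nat c) ^ m * w (r + 2)"
    using ge2.IH(1)[of "r + 2"] k2 by (simp add: add.commute add.left_commute)
  have "w (r + 2 * m + 4) = q r * w (r + 2 * m + 3) + of_nat c * w (r + 2 * m + 2)"
  proof -
    have "q (r + 2 * m + 2) = q r" "r + 2 * m + 2 + 2 = r + 2 * m + 4" "r + 2 * m + 2 + 1 = r + 2 * m + 3"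
      by (simp_all add: q_def)
    then show ?thesis
      using w_rec[of "r + 2 * m + 2"] by (simp only:)
  qed
  also have "\<dots> = (q r * ?k (m + 1) (r + 1)) * v (m + 1) * w (r + m + 2)
      + of_nat c * ?k m r * v m * w (r + m + 2)
      - of_nat c * (- of_nat c) ^ m * (w (r + 2) - q r * w (r + 1))"
    unfolding IH0 IH1 by (simp add: algebra_simps)
  also have "\<dots> = ?k m r * v (m + 2) * w (r + m + 2)
      - of_nat c * (- of_nat c) ^ m * (of_nat c * w r)"
    unfolding k1 v_rec w_rec[of r] by (simp add: algebra_simps)
  finally have "w (r + 2 * m + 4) = ?k (m + 2) r * v (m + 2) * w (r + (m + 2))
      - (- of_nat c) ^ (m + 2) * w r"
    using k2 by (simp add: add.assoc mult.assoc)
  then show ?case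
    by (simp add: eval_nat_numeral)
qed

text \<open>Pascal's rule: this is \<open>(x + d) ^ n * (x + d) = (x + d) ^ Suc n\<close> with each
  power \<open>x ^ i\<close> replaced by \<open>T i\<close>.\<close>

lemma sum_binomial_Suc:
  fixes T :: "nat \<Rightarrow> 'a::comm_semiring_1"
  shows "(\<Sum>i\<le>n. of_nat (n choose i) * d ^ (n - i) * (T (Suc i) + d * T i)) =
    (\<Sum>i\<le>Suc n. of_nat (Suc n choose i) * d ^ (Suc n - i) * T i)"
proof -
  let ?S = "\<Sum>i\<le>n. of_nat (n choose i) * d ^ (n - i) * T (Suc i)"
  \<comment> \<open>The added term \<open>i = Suc n\<close> vanishes since
    \<open>n choose Suc n = 0\<close>.\<close>
  have "(\<Sum>i\<le>Suc n. of_nat (n choose i) * d ^ (Suc n - i) * T i)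
      = (\<Sum>i\<le>n. of_nat (n choose i) * d ^ (n - i) * (d * T i))"
    by (simp add: Suc_diff_le binomial_eq_0 mult_ac)
  moreover have "(\<Sum>i\<le>Suc n. of_nat (n choose i) * d ^ (Suc n - i) * T i)
      = d ^ Suc n * T 0 + (\<Sum>i\<le>n. of_nat (n choose Suc i) * d ^ (n - i) * T (Suc i))"
    by (subst sum.atMost_Suc_shift) simp
  moreover have "(\<Sum>i\<le>Suc n. of_nat (Suc n choose i) * d ^ (Suc n - i) * T i)
      = d ^ Suc n * T 0 + (?S + (\<Sum>i\<le>n. of_nat (n choose Suc i) * d ^ (n - i) * T (Suc i)))"
    by (subst sum.atMost_Suc_shift) (simp add: sum.distrib distrib_right)
  ultimately show ?thesis
    by (simp add: distrib_left sum.distrib add_ac)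
qed

text \<open>\<open>e i r\<close> is the product of the parity factors at \<open>r\<close>,
  \<open>r + m\<close>, ..., \<open>r + (i - 1) * m\<close>. For odd \<open>m\<close> these indices
  alternate in parity, and the exponent counts the even ones: half of \<open>i\<close>, rounded up
  if \<open>r\<close> is even and down if \<open>r\<close> is odd.\<close>

lemma parity_exponent_Suc:
  fixes q :: "'a::field" and m :: nat
  assumes "q \<noteq> 0"
  defines "e \<equiv> \<lambda>i r. q powi (xi m * ((int i + xi i) div 2) - xi (i * m) * xi r)"
  shows "e (Suc i) r = parity_factor q m (r + i * m) * e i r"
proof (cases "odd m \<and> even (r + i * m)")
  case True
  then have "xi m * ((int (Suc i) + xi (Suc i)) div 2) - xi (Suc i * m) * xi r
      = 1 + (xi m * ((int i + xi i) div 2) - xi (i * m) * xi r)"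
    by (cases "even i"; cases "even r"; auto simp: xi_eq elim!: evenE oddE)
  then show ?thesis
    using True assms by (simp add: parity_factor_def power_int_add)
next
  case False
  then have "xi m * ((int (Suc i) + xi (Suc i)) div 2) - xi (Suc i * m) * xi r
      = xi m * ((int i + xi i) div 2) - xi (i * m) * xi r"
    by (cases "even i"; cases "even r"; auto simp: xi_eq elim!: evenE oddE)
  then show ?thesis
    using False by (auto simp: e_def parity_factor_def)
qed

theorem theorem3:
  fixes a b c n r m :: nat
    and w0 w1 :: "'a::field_char_0"
    and w v :: "nat \<Rightarrow> 'a"
  assumes "a > 0" and "b > 0" and "c > 0"
    and "w = biperiodic a b c w0 w1"
    and "v = biperiodic a b c 2 (of_nat b)"
    and "m > 1"
  shows "w (2 * m * n + r) =
    (\<Sum>i = 0..n. of_nat (n choose i) * (- 1) ^ ((m + 1) * (n - i))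
       * (of_nat a / of_nat b) powi (xi m * ((int i + xi i) div 2) - xi (i * m) * xi r)
       * of_nat c ^ (m * (n - i)) * v m ^ i * w (i * m + r))"
proof -
  define q :: 'a where "q = of_nat a / of_nat b"
  define e where "e i r = q powi (xi m * ((int i + xi i) div 2) - xi (i * m) * xi r)" for i r
  define d :: 'a where "d = - ((- of_nat c) ^ m)"
  have "q \<noteq> 0"
    using assms(1,2) by (simp add: q_def)
  then have e_Suc: "e (Suc i) r = parity_factor q m (r + i * m) * e i r" for i r
    unfolding e_def by (rule parity_exponent_Suc)
  have e_shift: "e i (2 * m + r) = e i r" for i r
    by (simp add: e_def xi_eq)
  have shift: "w (r + 2 * m) = parity_factor q m r * v m * w (r + m) + d * w r" for r
    unfolding assms(4,5) q_def d_def
    using biperiodic_double_shift[OF assms(2)] by simp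
  have "w (2 * m * n + r) = (\<Sum>i\<le>n. of_nat (n choose i) * d ^ (n - i) * (e i r * v m ^ i * w (i * m + r)))"
  \<comment> \<open>\<open>r\<close> varies because the hypothesis is applied at
    \<open>2 * m + r\<close>.\<close>
  proof (induction n arbitrary: r)
    case 0
    show ?case by (simp add: e_def xi_eq)
  next
    case (Suc n)
    define T where "T i = e i r * v m ^ i * w (i * m + r)" for i
    \<comment> \<open>The factor produced by \<open>shift\<close> at \<open>r + i * m\<close> is
      exactly the one that turns \<open>e i r\<close> into \<open>e (Suc i) r\<close>.\<close>
    have T: "e i (2 * m + r) * v m ^ i * w (i * m + (2 * m + r)) = T (Suc i) + d * T i" for i
    proof -
      have "w (i * m + (2 * m + r))
          = parity_factor q m (r + i * m) * v m * w (Suc i * m + r) + d * w (i * m + r)"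
        using shift[of "r + i * m"] by (simp add: add_ac)
      then show ?thesis
        unfolding T_def e_Suc e_shift by (simp add: distrib_left mult_ac)
    qed
    have "w (2 * m * Suc n + r) = w (2 * m * n + (2 * m + r))"
      by (simp add: algebra_simps)
    also have "\<dots> = (\<Sum>i\<le>n. of_nat (n choose i) * d ^ (n - i) * (T (Suc i) + d * T i))"
      unfolding Suc.IH T ..
    also have "\<dots> = (\<Sum>i\<le>Suc n. of_nat (Suc n choose i) * d ^ (Suc n - i) * T i)"
      by (rule sum_binomial_Suc)
    finally show ?case
      unfolding T_def .
  qed
  moreover have "d ^ k = (- 1) ^ ((m + 1) * k) * of_nat c ^ (m * k)" for k
  proof -
    have "d = (- 1) ^ (m + 1) * of_nat c ^ m"
      unfolding d_def by (subst power_minus) simp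
    then show ?thesis
      by (simp only: power_mult_distrib power_mult)
  qed
  ultimately show ?thesis
    by (simp add: e_def q_def atMost_atLeast0 mult_ac)
qed

end
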